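(* Let $n\ge 1$ and let $G\mapsto \mathbf{Z}_G\in\mathbb{R}^n$ be a map assigning to each graph $G$ an embedding vector. For graphs $G_Q,G_T$ define $$\mathcal{F}_s(\mathbf{Z}_{G_Q},\mathbf{Z}_{G_T})=\left\lVert \max\{0,\mathbf{Z}_{G_Q}-\mathbf{Z}_{G_T}\}\right\rVert_2 .$$ Then for all graphs $G_Q,G_T,G_{T'}$: 1. $\mathcal{F}_s(\mathbf{Z}_{G_Q},\mathbf{Z}_{G_T})\ge 0$; 2. $\mathcal{F}_s(\mathbf{Z}_{G_Q},\mathbf{Z}_{G_T})=0$ if and only if $\mathbf{Z}_{G_Q}\le \mathbf{Z}_{G_T}$; 3. $\mathcal{F}_s(\mathbf{Z}_{G_Q},\mathbf{Z}_{G_T})\le \mathcal{F}_s(\mathbf{Z}_{G_Q},\mathbf{Z}_{G_{T'}})+\mathcal{F}_s(\mathbf{Z}_{G_{T'}},\mathbf{Z}_{G_T})$.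
   Context: The maximum $\max\{0,\cdot\}$ (also written $\mathrm{ReLU}$) is applied coordinatewise to vectors in $\mathbb{R}^n$; the inequality $\mathbf{x}\le\mathbf{y}$ between vectors means $\mathbf{x}[i]\le\mathbf{y}[i]$ for every coordinate $i$; $\lVert\cdot\rVert_2$ is the Euclidean norm. In the paper the embedding map is computed by a graph neural network; the statement concerns only the resulting vectors in $\mathbb{R}^n$, regardless of which embedding map is used. *)

theory Defs
  imports "HOL-Analysis.Analysis"
begin

definition relu :: "real ^ 'n \<Rightarrow> real ^ 'n" where
  "relu x = (\<chi> i. max 0 (x $ i))"

text \<open>
  The norm on \<^typ>\<open>real ^ 'n\<close> is the Euclidean one, and \<open>\<le>\<close> on this type
  is the coordinatewise order.
\<close>

definition F_s :: "real ^ 'n \<Rightarrow> real ^ 'n \<Rightarrow> real" where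
  "F_s x y = norm (relu (x - y))"

end

theory Submission
  imports Defs
begin

text \<open>\<open>F_s x y\<close> depends only on \<open>x - y\<close>, through the map sending v
  to \<open>norm (relu v)\<close>. This map vanishes exactly when no coordinate of v is positive
  (\<open>relu_eq_0_iff\<close>). It is subadditive (\<open>norm_relu_add_le\<close>), because the
  positive part is subadditive in each coordinate and the Euclidean norm is monotone on nonnegative
  vectors. The triangle inequality follows by splitting x - z as (x - y) + (y - z).\<close>

lemma relu_eq_0_iff: "relu x = 0 \<longleftrightarrow> x \<le> 0"
  \<comment> \<open>\<open>max.absorb_iff1\<close> rewrites each coordinate inequality as an
    equation about \<open>max\<close>, which matches the left-hand side.\<close>
  unfolding relu_def vec_eq_iff less_eq_vec_def max.absorb_iff1 by simp

lemma norm_relu_add_le: "norm (relu (x + y)) \<le> norm (relu x) + norm (relu y)"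
proof -
  have "norm (relu (x + y)) \<le> norm (relu x + relu y)"
    \<comment> \<open>The rule compares absolute values of coordinates. Both vectors are
      nonnegative, so this reduces to max 0 (a + b) \<le> max 0 a + max 0 b.\<close>
    by (rule norm_le_componentwise_cart) (auto simp: relu_def max_def)
  also have "\<dots> \<le> norm (relu x) + norm (relu y)"
    by (rule norm_triangle_ineq)
  finally show ?thesis .
qed

lemma F_s_eq_0_iff: "F_s x y = 0 \<longleftrightarrow> x \<le> y"
  by (simp add: F_s_def relu_eq_0_iff less_eq_vec_def)

lemma F_s_triangle: "F_s x z \<le> F_s x y + F_s y z"
  using norm_relu_add_le[of "x - y" "y - z"] by (simp add: F_s_def)

theorem lemma1:
  fixes Z :: "'graph \<Rightarrow> real ^ 'n"
    and G\<^sub>Q G\<^sub>T G\<^sub>T' :: 'graph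
  shows "F_s (Z G\<^sub>Q) (Z G\<^sub>T) \<ge> 0 \<and>
    (F_s (Z G\<^sub>Q) (Z G\<^sub>T) = 0 \<longleftrightarrow> Z G\<^sub>Q \<le> Z G\<^sub>T) \<and>
    F_s (Z G\<^sub>Q) (Z G\<^sub>T) \<le> F_s (Z G\<^sub>Q) (Z G\<^sub>T') + F_s (Z G\<^sub>T') (Z G\<^sub>T)"
  using F_s_eq_0_iff F_s_triangle by (auto simp: F_s_def)

end
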